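(* For every integer $k\ge 1$, the olive tree $T_k$ is a difference graph.
   Context: A graph $G=(V,E)$ is a difference graph if there is a bijection $f$ from $V$ onto a set $S$ of positive integers such that for all distinct $x,y\in V$: $xy\in E$ if and only if $|f(x)-f(y)|\in S$. The olive tree $T_k$ is a rooted tree consisting of $k$ branches where, for $i=1,\dots,k$, the $i$-th branch is a path of length $i$ starting at the root; distinct branches share only the root. *)

theory Defs
  imports Main
begin

definition simple_graph :: "'a set \<Rightarrow> 'a set set \<Rightarrow> bool" where
  "simple_graph V E \<longleftrightarrow> E \<subseteq> {{x, y} | x y. x \<in> V \<and> y \<in> V \<and> x \<noteq> y}"

definition difference_graph :: "'a set \<Rightarrow> 'a set set \<Rightarrow> bool" where
  "difference_graph V E \<longleftrightarrow>
     simple_graph V E \<and>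
     (\<exists>(f :: 'a \<Rightarrow> int) S. (\<forall>s\<in>S. 0 < s) \<and> bij_betw f V S \<and>
        (\<forall>x\<in>V. \<forall>y\<in>V. x \<noteq> y \<longrightarrow> ({x, y} \<in> E \<longleftrightarrow> \<bar>f x - f y\<bar> \<in> S)))"

text \<open>
  The vertex at distance \<open>j\<close> from the root on the \<open>i\<close>-th branch. Position 0 of every
  branch is the common root (0, 0), so distinct branches share exactly the root.
\<close>

definition olive_vertex :: "nat \<Rightarrow> nat \<Rightarrow> nat \<times> nat" where
  "olive_vertex i j = (if j = 0 then (0, 0) else (i, j))"

text \<open>A path of length \<open>i\<close> has \<open>i\<close> edges, hence \<open>i + 1\<close> vertices including the root.\<close>

definition olive_verts :: "nat \<Rightarrow> (nat \<times> nat) set" where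
  "olive_verts k = {olive_vertex i j | i j. 1 \<le> i \<and> i \<le> k \<and> j \<le> i}"

definition olive_edges :: "nat \<Rightarrow> (nat \<times> nat) set set" where
  "olive_edges k =
     {{olive_vertex i j, olive_vertex i (Suc j)} | i j. 1 \<le> i \<and> i \<le> k \<and> j < i}"

end

theory Submission
  imports Defs
begin

text \<open>
  If a label \<open>x\<close> is a sum \<open>y + z\<close> of two labels, then \<open>x\<close> is joined to \<open>y\<close> and \<open>z\<close>; so the
  edges come as doublings \<open>x = 2 y\<close> or as cherries \<open>x = y + z\<close> centred at \<open>x\<close>. Give the root a
  label \<open>R\<close>, group the branches into pairs whose first vertices get labels \<open>a\<close> and \<open>R - a\<close>, and
  double along every branch. If \<open>k\<close> is odd, the unpaired branch of length 1 gets the label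
  \<open>R / 2\<close>. For independent values of \<open>R\<close> and the \<open>a\<close>'s no further sums occur; here the \<open>a\<close>'s are
  widely spaced powers of 2 and \<open>R\<close> is much larger.
\<close>

section \<open>Sums of powers of 2\<close>

lemma power_two_eq_sum:
  fixes a b c :: nat
  assumes "(2::int) ^ a = 2 ^ b + 2 ^ c"
  shows "b = c" and "a = Suc b"
proof -
  have aux: "c \<le> b" if eq: "(2::int) ^ a = 2 ^ b + 2 ^ c" for b c
  proof (rule ccontr)
    assume "\<not> c \<le> b"
    then obtain d where c: "c = Suc (b + d)"
      by (metis less_imp_Suc_add not_le)
    have "(2::int) ^ b < 2 ^ a"
      using eq by simp
    then have "b < a"
      by simp
    then obtain m where a: "a = Suc (b + m)"
      by (metis less_imp_Suc_add)
    \<comment> \<open>Cancelling the smaller power \<open>2 ^ b\<close> leaves an even number on the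
      left and an odd one on the right.\<close>
    have "(2::int) ^ b * (2 * 2 ^ m) = 2 ^ b * (1 + 2 * 2 ^ d)"
      using eq by (simp add: a c power_add algebra_simps)
    then have "(2::int) * 2 ^ m = 1 + 2 * 2 ^ d"
      by simp
    then show False
      by presburger
  qed
  show bc: "b = c"
    using aux[of c b] aux[of b c] assms by (simp add: add.commute)
  have "(2::int) ^ a = 2 ^ Suc b"
    using assms bc by simp
  then show "a = Suc b"
    by (simp only: power_inject_exp[of "2::int"] one_less_numeral_iff semiring_norm)
qed

section \<open>Vertices and edges of the olive tree\<close>

lemma olive_verts_eq:
  assumes "k \<ge> 1"
  shows "olive_verts k = insert (0, 0) {(i, j). 1 \<le> j \<and> j \<le> i \<and> i \<le> k}"
proof
  show "olive_verts k \<subseteq> insert (0, 0) {(i, j). 1 \<le> j \<and> j \<le> i \<and> i \<le> k}"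
    by (auto simp: olive_verts_def olive_vertex_def)
  have "\<exists>i' j'. x = olive_vertex i' j' \<and> 1 \<le> i' \<and> i' \<le> k \<and> j' \<le> i'"
    if "x \<in> insert (0, 0) {(i, j). 1 \<le> j \<and> j \<le> i \<and> i \<le> k}" for x
  proof (cases "x = (0, 0)")
    case True
    \<comment> \<open>The root lies on every branch; \<open>k \<ge> 1\<close> provides branch 1 as a
      witness.\<close>
    then have "x = olive_vertex 1 0 \<and> 1 \<le> (1::nat) \<and> 1 \<le> k \<and> 0 \<le> (1::nat)"
      using assms by (simp add: olive_vertex_def)
    then show ?thesis by blast
  next
    case False
    then obtain i j where "x = (i, j)" "1 \<le> j" "j \<le> i" "i \<le> k"
      using \<open>x \<in> _\<close> by blast
    then have "x = olive_vertex i j \<and> 1 \<le> i \<and> i \<le> k \<and> j \<le> i"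
      by (simp add: olive_vertex_def)
    then show ?thesis by blast
  qed
  then show "insert (0, 0) {(i, j). 1 \<le> j \<and> j \<le> i \<and> i \<le> k} \<subseteq> olive_verts k"
    unfolding olive_verts_def by blast
qed

lemma olive_edge_root:
  assumes "1 \<le> i" "i \<le> k"
  shows "{(0, 0), (i, 1)} \<in> olive_edges k"
proof -
  have "{(0, 0), (i, 1)} = {olive_vertex i 0, olive_vertex i (Suc 0)}"
    by (simp add: olive_vertex_def)
  then show ?thesis
    using assms unfolding olive_edges_def by fastforce
qed

lemma olive_edge_step:
  assumes "1 \<le> j" "j < i" "i \<le> k"
  shows "{(i, j), (i, Suc j)} \<in> olive_edges k"
proof -
  have "{(i, j), (i, Suc j)} = {olive_vertex i j, olive_vertex i (Suc j)}"
    using assms by (simp add: olive_vertex_def)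
  moreover have "1 \<le> i"
    using assms by simp
  ultimately show ?thesis
    using assms unfolding olive_edges_def by blast
qed

lemma olive_edge_cases:
  assumes "e \<in> olive_edges k"
  obtains (root) i where "1 \<le> i" "i \<le> k" "e = {(0, 0), (i, 1)}"
  | (step) i j where "1 \<le> j" "j < i" "i \<le> k" "e = {(i, j), (i, Suc j)}"
proof -
  obtain i j where e: "e = {olive_vertex i j, olive_vertex i (Suc j)}" "1 \<le> i" "i \<le> k" "j < i"
    using assms unfolding olive_edges_def by blast
  show thesis
    using e root[of i] step[of j i] by (cases "j = 0") (auto simp: olive_vertex_def)
qed

lemma simple_graph_olive:
  assumes "k \<ge> 1"
  shows "simple_graph (olive_verts k) (olive_edges k)"
  unfolding simple_graph_def
proof
  fix e assume "e \<in> olive_edges k"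
  then show "e \<in> {{x, y} | x y. x \<in> olive_verts k \<and> y \<in> olive_verts k \<and> x \<noteq> y}"
  proof (cases rule: olive_edge_cases)
    case (root i)
    then have "(0, 0) \<in> olive_verts k" "(i, 1) \<in> olive_verts k" "(0, 0) \<noteq> (i, 1)"
      by (auto simp: olive_verts_eq[OF assms])
    then show ?thesis
      using root by blast
  next
    case (step i j)
    then have "(i, j) \<in> olive_verts k" "(i, Suc j) \<in> olive_verts k" "(i, j) \<noteq> (i, Suc j)"
      by (auto simp: olive_verts_eq[OF assms])
    then show ?thesis
      using step by blast
  qed
qed

section \<open>The labels and their two coordinates\<close>

text \<open>Two digits in base \<open>k + 1\<close>: each branch owns a block of exponents, and a
  step away from the root raises the exponent by one, which doubles the power. Levels are at most
  \<open>k\<close>, so both digits can be read off.\<close>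

definition olive_exp :: "nat \<Rightarrow> nat \<Rightarrow> nat \<Rightarrow> nat" where
  "olive_exp k i j = i * Suc k + j"

lemma olive_exp_Suc: "olive_exp k i (Suc j) = Suc (olive_exp k i j)"
  by (simp add: olive_exp_def)

lemma olive_exp_eqD:
  assumes "olive_exp k i j = olive_exp k i' j'" "j \<le> k" "j' \<le> k"
  shows "i = i'" "j = j'"
proof -
  have "(m * Suc k + n) div Suc k = m" if "n \<le> k" for m n
  proof -
    have "(n + m * Suc k) div Suc k = m + n div Suc k"
      by (rule div_mult_self1) simp
    then show ?thesis
      using that by (simp only: add.commute[of n] div_less less_Suc_eq_le add_0_right)
  qed
  then show "i = i'"
    using assms unfolding olive_exp_def by metis
  then show "j = j'"
    using assms by (simp add: olive_exp_def)
qed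

text \<open>The bound \<open>1 \<le> j\<close> excludes a carry between blocks: the exponent after
  that of \<open>(i', k)\<close> belongs to \<open>(i' + 1, 0)\<close>, a level that no label
  uses.\<close>

lemma olive_exp_eq_SucD:
  assumes "olive_exp k i j = Suc (olive_exp k i' j')" "1 \<le> j" "j \<le> k" "j' \<le> k"
  shows "i = i'" "j = Suc j'"
proof -
  have "olive_exp k i (j - 1) = olive_exp k i' j'"
    using assms by (simp add: olive_exp_def)
  moreover have "j - 1 \<le> k"
    using assms by simp
  ultimately have "i = i'" "j - 1 = j'"
    using olive_exp_eqD assms(4) by blast+
  then show "i = i'" "j = Suc j'"
    using assms by simp_all
qed

lemma olive_exp_le:
  assumes "i \<le> k" "j \<le> k"
  shows "olive_exp k i j \<le> Suc k * Suc k"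
proof -
  have "i * Suc k \<le> k * Suc k"
    using assms by (intro mult_le_mono1)
  then show ?thesis
    using assms by (simp add: olive_exp_def)
qed

text \<open>
  The label of \<open>x\<close> will be \<open>olive_hi k x * H + olive_lo k x\<close> with \<open>H = R / 2\<close>. Branch \<open>i\<close> with
  \<open>k + i\<close> odd is paired with branch \<open>i + 1\<close>.
\<close>

fun olive_hi :: "nat \<Rightarrow> nat \<times> nat \<Rightarrow> int" where
  "olive_hi k (i, j) =
     (if i = 0 then 2 else if odd (k + i) then 0 else if i = 1 then 1 else 2 ^ j)"

fun olive_lo :: "nat \<Rightarrow> nat \<times> nat \<Rightarrow> int" where
  "olive_lo k (i, j) =
     (if i = 0 then 0 else if odd (k + i) then 2 ^ olive_exp k i j
      else if i = 1 then 0 else - (2 ^ olive_exp k (i - 1) j))"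

text \<open>In the case \<open>high\<close>, \<open>i\<close> names the partner branch and not the
  branch of \<open>x\<close>, so that partners share the exponent \<open>olive_exp k i j\<close>
  with opposite signs.\<close>

lemma olive_label_cases:
  assumes "k \<ge> 1" "x \<in> olive_verts k"
  obtains (root) "x = (0, 0)" "olive_hi k x = 2" "olive_lo k x = 0"
  | (half) "x = (1, 1)" "olive_hi k x = 1" "olive_lo k x = 0"
  | (low) i j where "x = (i, j)" "1 \<le> j" "j \<le> i" "i \<le> k" "j \<le> k"
      "olive_hi k x = 0" "olive_lo k x = 2 ^ olive_exp k i j"
  | (high) i j where "x = (Suc i, j)" "1 \<le> i" "1 \<le> j" "j \<le> Suc i" "Suc i \<le> k" "j \<le> k"
      "olive_hi k x = 2 ^ j" "olive_lo k x = - (2 ^ olive_exp k i j)"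
proof -
  consider "x = (0, 0)" | i j where "x = (i, j)" "1 \<le> j" "j \<le> i" "i \<le> k"
    using assms by (auto simp: olive_verts_eq)
  then show thesis
  proof cases
    case 1
    then show thesis using root by simp
  next
    case (2 i j)
    consider "odd (k + i)" | "even (k + i)" "i = 1" | "even (k + i)" "i \<ge> 2"
      using 2 by linarith
    then show thesis
    proof cases
      case 1
      with 2 show thesis by (intro low[of i j]) auto
    next
      case 2
      with \<open>x = (i, j)\<close> \<open>1 \<le> j\<close> \<open>j \<le> i\<close> show thesis by (intro half) auto
    next
      case 3
      with 2 show thesis by (intro high[of "i - 1" j]) auto
    qed
  qed
qed

declare olive_hi.simps [simp del] olive_lo.simps [simp del]

section \<open>Coordinate pairs: injectivity, and sums against edges\<close>

lemma olive_label_inj: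
  assumes k: "k \<ge> 1" and x: "x \<in> olive_verts k" and y: "y \<in> olive_verts k"
    and hi: "olive_hi k x = olive_hi k y" and lo: "olive_lo k x = olive_lo k y"
  shows "x = y"
proof -
  show ?thesis
    using k x
  proof (cases rule: olive_label_cases)
    case root
    show ?thesis using k y by (cases rule: olive_label_cases) (use root hi lo in auto)
  next
    case half
    show ?thesis using k y by (cases rule: olive_label_cases) (use half hi lo in auto)
  next
    case low: (low i j)
    show ?thesis
      using k y by (cases rule: olive_label_cases) (use low hi lo in \<open>auto dest: olive_exp_eqD\<close>)
  next
    case high: (high i j)
    show ?thesis
      using k y
    proof (cases rule: olive_label_cases)
      case (high i' j')
      then have "olive_exp k i j = olive_exp k i' j'"
        using \<open>olive_lo k x = - _\<close> lo by simp
      then show ?thesis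
        using olive_exp_eqD high \<open>x = (Suc i, j)\<close> \<open>j \<le> k\<close> by blast
    qed (use high hi lo in auto)
  qed
qed

text \<open>Case analysis on the shape of the sum \<open>x\<close>. The \<open>lo\<close> parts
  decide which powers can cancel or double, and the \<open>hi\<close> parts then compare levels.
  Since \<open>y\<close> and \<open>z\<close> may coincide, doublings and cherries are treated
  together.\<close>

lemma olive_label_sum_imp_edge:
  assumes k: "k \<ge> 1"
    and x: "x \<in> olive_verts k" and y: "y \<in> olive_verts k" and z: "z \<in> olive_verts k"
    and hi: "olive_hi k x = olive_hi k y + olive_hi k z"
    and lo: "olive_lo k x = olive_lo k y + olive_lo k z"
  shows "{x, y} \<in> olive_edges k"
proof -
  have pos: "(2::int) ^ n > 0" "(2::int) ^ n \<noteq> 0" "0 \<noteq> (2::int) ^ n" for n :: nat by simp_all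
  have sum_pos: "(2::int) ^ m + 2 ^ n \<noteq> 0" "0 \<noteq> (2::int) ^ m + 2 ^ n"
    "- ((2::int) ^ m) - 2 ^ n \<noteq> 0" "- ((2::int) ^ m) \<noteq> 2 ^ n" for m n :: nat
    using pos(1)[of m] pos(1)[of n] by linarith+
  have root_edge: "{(0, 0), (i, j)} \<in> olive_edges k"
    if "1 \<le> j" "1 \<le> i" "i \<le> k" "(2::int) ^ j = 2" for i j
  proof -
    have "j = 1"
      using that power_inject_exp[of "2::int" j 1] by simp
    then show ?thesis using that olive_edge_root by simp
  qed
  show ?thesis
    using k x
  proof (cases rule: olive_label_cases)
    case xr: root
    show ?thesis
      using k y
    proof (cases rule: olive_label_cases)
      case root
      show ?thesis
        using k z by (cases rule: olive_label_cases) (use xr root hi lo in auto)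
    next
      case half
      then show ?thesis
        using xr olive_edge_root[of 1 k] k by simp
    next
      case yl: (low i j)
      show ?thesis
        using k z
      proof (cases rule: olive_label_cases)
        case (high i' j')
        \<comment> \<open>The \<open>lo\<close> parts must cancel, so \<open>z\<close> sits at the
          same level of the partner branch; its \<open>hi\<close> part \<open>2 ^ j\<close> must be
          2, so this is level 1.\<close>
        have "olive_exp k i j = olive_exp k i' j'"
          using high xr yl lo by simp
        then have "j = j'"
          using olive_exp_eqD high yl by blast
        then show ?thesis
          using high xr yl hi root_edge[of j i] by simp
      qed (use xr yl hi lo pos sum_pos in auto)
    next
      case yh: (high i j)
      show ?thesis
        using k z
      proof (cases rule: olive_label_cases)
        case (low i' j')
        then show ?thesis
          using xr yh hi root_edge[of j "Suc i"] by simp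
      qed (use xr yh hi lo pos sum_pos in auto)
    qed
  next
    case xh: half
    have one_less: "1 < (2::int) ^ j" if "1 \<le> j" for j
      using one_less_power[of "2::int" j] that by simp
    have ge: "olive_hi k w \<noteq> 1 \<or> olive_lo k w = 0" if "w \<in> olive_verts k" for w
      using k that
    proof (cases rule: olive_label_cases)
      case (high i j)
      then show ?thesis
        using one_less[of j] by linarith
    qed simp_all
    have nn: "0 \<le> olive_hi k w \<and> (olive_hi k w = 0 \<longrightarrow> olive_lo k w > 0)"
      if "w \<in> olive_verts k" for w
      using k that by (cases rule: olive_label_cases) auto
    \<comment> \<open>One summand would have \<open>hi\<close> 1, hence \<open>lo\<close> 0, and the
      other \<open>hi\<close> 0, hence \<open>lo\<close> positive; the \<open>lo\<close> parts could
      not add up to 0. So \<open>R / 2\<close> is never a sum.\<close>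
    have "olive_hi k y + olive_hi k z = 1" "olive_lo k y + olive_lo k z = 0"
      using xh hi lo by simp_all
    then have False
      using ge[OF y] ge[OF z] nn[OF y] nn[OF z] by presburger
    then show ?thesis ..
  next
    case xl: (low i j)
    have nn: "0 \<le> olive_hi k w" if "w \<in> olive_verts k" for w
      using k that by (cases rule: olive_label_cases) auto
    \<comment> \<open>No \<open>hi\<close> part is negative, so both summands are low, and a power
      of 2 splits into two powers only as a doubling.\<close>
    have y0: "olive_hi k y = 0" and z0: "olive_hi k z = 0"
      using xl hi nn[OF y] nn[OF z] by linarith+
    have low0: "\<exists>i j. w = (i, j) \<and> 1 \<le> j \<and> j \<le> i \<and> i \<le> k \<and> j \<le> k \<and>
        olive_lo k w = 2 ^ olive_exp k i j"
      if "w \<in> olive_verts k" "olive_hi k w = 0" for w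
      using k that(1) by (cases rule: olive_label_cases) (use that(2) in auto)
    obtain i1 j1 where y1: "y = (i1, j1)" "1 \<le> j1" "j1 \<le> i1" "i1 \<le> k" "j1 \<le> k"
      "olive_lo k y = 2 ^ olive_exp k i1 j1"
      using low0[OF y y0] by blast
    obtain i2 j2 where z1: "z = (i2, j2)" "olive_lo k z = 2 ^ olive_exp k i2 j2"
      using low0[OF z z0] by blast
    have "(2::int) ^ olive_exp k i j = 2 ^ olive_exp k i1 j1 + 2 ^ olive_exp k i2 j2"
      using lo xl y1 z1 by simp
    then have "olive_exp k i j = Suc (olive_exp k i1 j1)"
      by (rule power_two_eq_sum)
    then have "i = i1" "j = Suc j1"
      using olive_exp_eq_SucD xl y1 by blast+
    then show ?thesis
      using olive_edge_step[of j1 i1 k] xl y1 by (simp add: insert_commute)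
  next
    case xh: (high i j)
    show ?thesis
      using k y
    proof (cases rule: olive_label_cases)
      case yr: root
      show ?thesis
        using k z
      proof (cases rule: olive_label_cases)
        case (high i' j')
        then have "olive_exp k i j = olive_exp k i' j'"
          using xh yr lo by simp
        \<comment> \<open>Equal levels give \<open>x\<close> and \<open>z\<close> the same
          \<open>hi\<close> part, which leaves 0 for the root, where it is 2.\<close>
        then have "j = j'"
          using olive_exp_eqD high xh by blast
        then show ?thesis
          using high xh yr hi by simp
      qed (use xh yr hi lo pos sum_pos in auto)
    next
      case yr: half
      show ?thesis
        using k z
      proof (cases rule: olive_label_cases)
        case (high i' j')
        then have "olive_exp k i j = olive_exp k i' j'"
          using xh yr lo by simp
        then have "j = j'"
          using olive_exp_eqD high xh by blast
        then show ?thesis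
          using high xh yr hi by simp
      qed (use xh yr hi lo pos sum_pos in auto)
    next
      case yl: (low i1 j1)
      show ?thesis
        using k z
      proof (cases rule: olive_label_cases)
        case zh: (high i2 j2)
        \<comment> \<open>The coordinates disagree: \<open>hi\<close> puts \<open>x\<close> and
          \<open>z\<close> at the same level, while \<open>lo\<close> puts \<open>z\<close> one
          level further out.\<close>
        have "j = j2"
          using xh yl zh hi by simp
        have "(2::int) ^ olive_exp k i2 j2 = 2 ^ olive_exp k i j + 2 ^ olive_exp k i1 j1"
          using xh yl zh lo by simp
        then have "olive_exp k i2 j2 = Suc (olive_exp k i j)"
          by (rule power_two_eq_sum)
        then have "j2 = Suc j"
          using olive_exp_eq_SucD zh xh by blast
        then show ?thesis
          using \<open>j = j2\<close> by simp
      next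
        case root
        then show ?thesis using xh yl lo pos(1)[of "olive_exp k i j"] pos(1)[of "olive_exp k i1 j1"] by simp
      next
        case half
        then show ?thesis using xh yl lo pos(1)[of "olive_exp k i j"] pos(1)[of "olive_exp k i1 j1"] by simp
      next
        case low
        then show ?thesis using xh yl hi by simp
      qed
    next
      case yh: (high i1 j1)
      show ?thesis
        using k z
      proof (cases rule: olive_label_cases)
        case zh: (high i2 j2)
        have "(2::int) ^ olive_exp k i j = 2 ^ olive_exp k i1 j1 + 2 ^ olive_exp k i2 j2"
          using lo xh yh zh by simp
        then have "olive_exp k i j = Suc (olive_exp k i1 j1)"
          by (rule power_two_eq_sum)
        then have "i = i1" "j = Suc j1"
          using olive_exp_eq_SucD xh yh by blast+
        then show ?thesis
          using olive_edge_step[of j1 "Suc i1" k] xh yh by (simp add: insert_commute)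
      next
        case zl: (low i2 j2)
        have "j = j1"
          using xh yh zl hi by simp
        have "(2::int) ^ olive_exp k i1 j1 = 2 ^ olive_exp k i j + 2 ^ olive_exp k i2 j2"
          using xh yh zl lo by simp
        then have "olive_exp k i1 j1 = Suc (olive_exp k i j)"
          by (rule power_two_eq_sum)
        then have "j1 = Suc j"
          using olive_exp_eq_SucD yh xh by blast
        then show ?thesis
          using \<open>j = j1\<close> by simp
      next
        case root
        then have "olive_exp k i j = olive_exp k i1 j1"
          using xh yh lo by simp
        then have "j = j1"
          using olive_exp_eqD yh xh by blast
        then show ?thesis using xh yh root hi by simp
      next
        case half
        then have "olive_exp k i j = olive_exp k i1 j1"
          using xh yh lo by simp
        then have "j = j1"
          using olive_exp_eqD yh xh by blast
        then show ?thesis using xh yh half hi by simp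
      qed
    qed
  qed
qed

lemma olive_edge_imp_label_sum:
  assumes "k \<ge> 1" "{x, y} \<in> olive_edges k"
  shows "\<exists>z\<in>olive_verts k.
    olive_hi k x = olive_hi k y + olive_hi k z \<and> olive_lo k x = olive_lo k y + olive_lo k z \<or>
    olive_hi k y = olive_hi k x + olive_hi k z \<and> olive_lo k y = olive_lo k x + olive_lo k z"
  using assms(2)
proof (cases rule: olive_edge_cases)
  case (root i)
  \<comment> \<open>The other summand of the root label: the first vertex of the partner branch, or
    \<open>(1, 1)\<close> itself if branch 1 is unpaired, since \<open>R / 2\<close> is then
    doubled.\<close>
  define z where "z = (if odd (k + i) then (Suc i, 1::nat) else if i = 1 then (1, 1) else (i - 1, 1))"
  have z: "z \<in> olive_verts k"
  proof (cases "odd (k + i)")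
    case True
    \<comment> \<open>The longest branch has \<open>k + i\<close> even, so a branch with
      \<open>k + i\<close> odd always has its partner \<open>i + 1\<close> in the tree.\<close>
    then have "i \<noteq> k"
      by auto
    then have "Suc i \<le> k"
      using root by simp
    then show ?thesis
      using True assms by (simp add: z_def olive_verts_eq)
  next
    case False
    have "i = 1 \<or> 1 \<le> i - 1 \<and> i - 1 \<le> k"
      using root by linarith
    then show ?thesis
      using False root assms(1) by (auto simp: z_def olive_verts_eq)
  qed
  have "olive_hi k (0, 0) = olive_hi k (i, 1) + olive_hi k z \<and>
    olive_lo k (0, 0) = olive_lo k (i, 1) + olive_lo k z"
  proof (cases "odd (k + i)")
    case True
    then show ?thesis
      using root by (simp add: z_def olive_hi.simps olive_lo.simps)
  next
    case False
    then show ?thesis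
      using root by (cases "i = 1") (simp_all add: z_def olive_hi.simps olive_lo.simps)
  qed
  then show ?thesis
    using root(3) z unfolding doubleton_eq_iff by blast
next
  case (step i j)
  then have z: "(i, j) \<in> olive_verts k"
    using assms(1) by (auto simp: olive_verts_eq)
  \<comment> \<open>Away from the root the edge is a doubling, so the witness is the inner vertex
    itself.\<close>
  have "olive_hi k (i, Suc j) = olive_hi k (i, j) + olive_hi k (i, j)"
    "olive_lo k (i, Suc j) = olive_lo k (i, j) + olive_lo k (i, j)"
    using step by (auto simp: olive_exp_Suc olive_hi.simps olive_lo.simps)
  then show ?thesis
    using step(4) z unfolding doubleton_eq_iff by blast
qed

section \<open>From coordinate pairs to positive integers\<close>

lemma olive_lo_bound:
  assumes "k \<ge> 1" "x \<in> olive_verts k"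
  shows "\<bar>olive_lo k x\<bar> \<le> 2 ^ (Suc k * Suc k)"
  using assms
proof (cases rule: olive_label_cases)
  case (low i j)
  then show ?thesis
    using olive_exp_le[of i k j] by (simp del: mult_Suc mult_Suc_right add: power_increasing)
next
  case (high i j)
  then show ?thesis
    using olive_exp_le[of i k j] by (simp del: mult_Suc mult_Suc_right add: power_increasing)
qed simp_all

text \<open>A nonzero \<open>a\<close> would force \<open>\<bar>b\<bar>\<close> to be at least
  \<open>H\<close>. This splits one integer relation between labels into a relation for each
  coordinate.\<close>

lemma mult_add_eq_0_imp:
  fixes a b H :: int
  assumes "a * H + b = 0" "\<bar>b\<bar> < H"
  shows "a = 0" "b = 0"
proof -
  show "a = 0"
  proof (rule ccontr)
    assume "a \<noteq> 0"
    have "\<bar>b\<bar> = \<bar>a\<bar> * \<bar>H\<bar>"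
      using assms(1) by (metis abs_minus_cancel abs_mult add_eq_0_iff)
    moreover have "1 * \<bar>H\<bar> \<le> \<bar>a\<bar> * \<bar>H\<bar>"
      using \<open>a \<noteq> 0\<close> by (intro mult_right_mono) auto
    ultimately show False
      using assms(2) by linarith
  qed
  then show "b = 0"
    using assms(1) by simp
qed

theorem theorem3p10:
  fixes k :: nat
  assumes "k \<ge> 1"
  shows "difference_graph (olive_verts k) (olive_edges k)"
proof -
  let ?V = "olive_verts k"
  define M :: int where "M = 2 ^ (Suc k * Suc k)"
  \<comment> \<open>The factor \<open>4 * M\<close> is \<open>R / 2\<close>. A relation between
    three labels has a total \<open>lo\<close> part of at most \<open>3 * M\<close> in absolute
    value, so nothing spills over into the \<open>hi\<close> part.\<close>
  define f where "f x = olive_hi k x * (4 * M) + olive_lo k x" for x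
  have M: "M > 0"
    by (simp add: M_def)
  have bound: "\<bar>olive_lo k x\<bar> \<le> M" if "x \<in> ?V" for x
    using olive_lo_bound[OF assms that] by (simp add: M_def)
  have f_sum: "f x = f y + f z \<longleftrightarrow>
      olive_hi k x = olive_hi k y + olive_hi k z \<and> olive_lo k x = olive_lo k y + olive_lo k z"
    if "x \<in> ?V" "y \<in> ?V" "z \<in> ?V" for x y z
  proof
    assume "f x = f y + f z"
    then have "(olive_hi k x - olive_hi k y - olive_hi k z) * (4 * M)
        + (olive_lo k x - olive_lo k y - olive_lo k z) = 0"
      by (simp add: f_def algebra_simps)
    moreover have "\<bar>olive_lo k x - olive_lo k y - olive_lo k z\<bar> < 4 * M"
      using bound[OF that(1)] bound[OF that(2)] bound[OF that(3)] M by linarith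
    ultimately have "olive_hi k x - olive_hi k y - olive_hi k z = 0"
      "olive_lo k x - olive_lo k y - olive_lo k z = 0"
      using mult_add_eq_0_imp by blast+
    then show "olive_hi k x = olive_hi k y + olive_hi k z \<and>
        olive_lo k x = olive_lo k y + olive_lo k z"
      by simp
  qed (simp add: f_def algebra_simps)
  have "inj_on f ?V"
  proof (rule inj_onI)
    fix x y assume xy: "x \<in> ?V" "y \<in> ?V" and eq: "f x = f y"
    have "(olive_hi k x - olive_hi k y) * (4 * M) + (olive_lo k x - olive_lo k y) = 0"
      using eq by (simp add: f_def algebra_simps)
    moreover have "\<bar>olive_lo k x - olive_lo k y\<bar> < 4 * M"
      using bound[OF xy(1)] bound[OF xy(2)] M by linarith
    ultimately have "olive_hi k x - olive_hi k y = 0" "olive_lo k x - olive_lo k y = 0"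
      using mult_add_eq_0_imp by blast+
    then show "x = y"
      using olive_label_inj[OF assms xy] by simp
  qed
  then have bij: "bij_betw f ?V (f ` ?V)"
    by (rule inj_on_imp_bij_betw)
  have f_pos: "0 < f x" if x: "x \<in> ?V" for x
    using assms x
  proof (cases rule: olive_label_cases)
    case (high i j)
    \<comment> \<open>Only high labels have a negative \<open>lo\<close> part; it is at least
      \<open>- M\<close> and is outweighed by \<open>4 * M\<close>.\<close>
    have "1 * (4 * M) \<le> olive_hi k x * (4 * M)"
      using M high by (intro mult_right_mono) auto
    then show ?thesis
      using bound[OF x] M unfolding f_def by linarith
  qed (use M in \<open>simp_all add: f_def\<close>)
  have adj: "{x, y} \<in> olive_edges k \<longleftrightarrow> \<bar>f x - f y\<bar> \<in> f ` ?V"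
    if xy: "x \<in> ?V" "y \<in> ?V" for x y
  proof
    assume "{x, y} \<in> olive_edges k"
    from olive_edge_imp_label_sum[OF assms this]
    obtain z where z: "z \<in> ?V" "f x = f y + f z \<or> f y = f x + f z"
      using f_sum[OF xy] f_sum[OF xy(2,1)] by blast
    then have "\<bar>f x - f y\<bar> = f z"
      using f_pos[OF z(1)] by auto
    then show "\<bar>f x - f y\<bar> \<in> f ` ?V"
      using z(1) by simp
  next
    assume "\<bar>f x - f y\<bar> \<in> f ` ?V"
    then obtain z where z: "z \<in> ?V" "\<bar>f x - f y\<bar> = f z"
      by blast
    \<comment> \<open>The absolute value hides which endpoint is the sum; the second case is the
      first with \<open>x\<close> and \<open>y\<close> exchanged.\<close>
    then consider "f x = f y + f z" | "f y = f x + f z"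
      by linarith
    then show "{x, y} \<in> olive_edges k"
    proof cases
      case 1
      then show ?thesis
        using f_sum[OF xy z(1)] olive_label_sum_imp_edge[OF assms xy z(1)] by blast
    next
      case 2
      then have "{y, x} \<in> olive_edges k"
        using f_sum[OF xy(2,1) z(1)] olive_label_sum_imp_edge[OF assms xy(2,1) z(1)] by blast
      then show ?thesis
        by (simp add: insert_commute)
    qed
  qed
  show ?thesis
    unfolding difference_graph_def
    using simple_graph_olive[OF assms] bij f_pos adj by blast
qed

end
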